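(* Let $\phi:\mathbb{R}^q\to\mathbb{R}^q$ act componentwise and satisfy $|\phi(r)-\phi(s)|\le |r-s|$ for all $r,s\in\mathbb{R}^q$ (componentwise). Let $W\in\mathbb{R}^{q\times q}$, $U\in\mathbb{R}^{q\times p}$, $V\in\mathbb{R}^{m\times q}$, $K\in\mathbb{R}^{m\times p}$, $b\in\mathbb{R}^q$, $d\in\mathbb{R}^m$. If $\lambda_{\mathrm{pf}}(|W|)<1$, then for every $y\in\mathbb{R}^p$ and every bias $b\in\mathbb{R}^q$ the equation $$\eta=\phi(W\eta+Uy+b)$$ has a unique solution $\eta=\eta(y)\in\mathbb{R}^q$. Moreover, for all $y_1,y_2\in\mathbb{R}^p$, $$|\eta(y_1)-\eta(y_2)|\le (I-|W|)^{-1}|U|\,|y_1-y_2|.$$ Consequently, the controller map $\pi(y)=Ky+V\eta(y)+d$ is globally Lipschitz and $$|\pi(y_1)-\pi(y_2)|\le\left(|K|+|V|(I-|W|)^{-1}|U|\right)|y_1-y_2|$$ for all $y_1,y_2\in\mathbb{R}^p$.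
   Context: For a matrix or vector $M$, $|M|$ denotes the componentwise absolute value, and inequalities between vectors are componentwise. For a square matrix $M$ with nonnegative entries, $\lambda_{\mathrm{pf}}(M)$ is its Perron--Frobenius eigenvalue (equal to its spectral radius). "$\phi$ acts componentwise" means $\phi(r)_i=\phi_i(r_i)$ for scalar functions $\phi_i:\mathbb{R}\to\mathbb{R}$. *)

theory Defs
  imports "HOL-Analysis.Analysis"
begin

text \<open>
  The library order and absolute value on \<^typ>\<open>real ^ 'n\<close> and, by nesting, on
  \<^typ>\<open>real ^ 'n ^ 'm\<close>, are the componentwise (entrywise) ones.
\<close>

definition acts_componentwise :: "(real ^ 'q \<Rightarrow> real ^ 'q) \<Rightarrow> bool" where
  "acts_componentwise \<phi> \<longleftrightarrow>
     (\<exists>f :: 'q \<Rightarrow> real \<Rightarrow> real. \<forall>r i. \<phi> r $ i = f i (r $ i))"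

text \<open>
  The eigenvalues of a real matrix are taken over the complex numbers; they form a finite
  nonempty set, so the maximum below is a genuine one.
\<close>

definition complex_spectrum :: "real ^ 'n ^ 'n \<Rightarrow> complex set" where
  "complex_spectrum M =
     {c. \<exists>v :: complex ^ 'n. v \<noteq> 0 \<and> map_matrix complex_of_real M *v v = c *s v}"

text \<open>
  For a matrix with nonnegative entries, the Perron-Frobenius eigenvalue is the spectral radius.
  Only such matrices are of interest here, although the definition makes sense in general.
\<close>

definition pf_eigenvalue :: "real ^ 'n ^ 'n \<Rightarrow> real" where
  "pf_eigenvalue M = Max (cmod ` complex_spectrum M)"

text \<open>
  The definite description is meaningful only when the fixed-point equation has exactly one
  solution.
\<close>

definition equilibrium ::
  "(real ^ 'q \<Rightarrow> real ^ 'q) \<Rightarrow> real ^ 'q ^ 'q \<Rightarrow> real ^ 'p ^ 'q \<Rightarrow> real ^ 'q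
    \<Rightarrow> real ^ 'p \<Rightarrow> real ^ 'q" where
  "equilibrium \<phi> W U b y = (THE \<eta>. \<eta> = \<phi> (W *v \<eta> + U *v y + b))"

definition controller ::
  "(real ^ 'q \<Rightarrow> real ^ 'q) \<Rightarrow> real ^ 'q ^ 'q \<Rightarrow> real ^ 'p ^ 'q \<Rightarrow> real ^ 'q
    \<Rightarrow> real ^ 'p ^ 'm \<Rightarrow> real ^ 'q ^ 'm \<Rightarrow> real ^ 'm \<Rightarrow> real ^ 'p \<Rightarrow> real ^ 'm" where
  "controller \<phi> W U b K V d y = K *v y + V *v equilibrium \<phi> W U b y + d"

end

theory Submission
  imports Defs "HOL-Computational_Algebra.Polynomial"
begin

text \<open>
  Put \<open>A = \<bar>W\<bar>\<close>. Since \<open>A\<close> has no real eigenvalue in \<open>[1, \<infinity>)\<close>, the matrix \<open>I - t A\<close> is invertible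
  for \<open>0 \<le> t \<le> 1\<close>, and the solution \<open>x(t)\<close> of \<open>(I - t A) x = 1\<close> depends continuously on \<open>t\<close>.
  Whenever \<open>x(t) \<ge> 0\<close>, even \<open>x(t) = 1 + t A x(t) \<ge> 1\<close>, so by connectedness \<open>x(t) \<ge> 1\<close> for all
  \<open>t\<close>. Thus \<open>v = x(1)\<close> is a positive vector with \<open>A v = v - 1\<close>. Comparison with \<open>v\<close> shows that
  \<open>I - A\<close> reflects nonnegativity, which gives uniqueness and the estimates; and large multiples
  of the order interval \<open>[-v, v]\<close> are mapped into themselves by the fixed-point map, so Brouwer's
  theorem gives existence.
\<close>

section \<open>The spectrum\<close>

lemma poly_det:
  fixes P :: "'a::comm_ring_1 poly ^ 'n ^ 'n"
  shows "poly (det P) t = det (\<chi> i j. poly (P $ i $ j) t)"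
  by (simp add: det_def poly_sum poly_prod)

text \<open>Since \<open>t c = 1\<close>, the vector \<open>v - t M v\<close> vanishes, so
  \<open>v\<close> is a kernel vector of \<open>I - t M\<close>. The matrix is written entrywise to
  match the evaluated determinant in \<open>poly_det\<close>.\<close>

lemma eigenvector_imp_det_eq_0:
  fixes M :: "'a::field ^ 'n ^ 'n"
  assumes "M *v v = c *s v" "v \<noteq> 0" "t * c = 1"
  shows "det (\<chi> i j. (if i = j then 1 else 0) - t * M $ i $ j) = 0"
proof -
  let ?B = "(\<chi> i j. (if i = j then 1 else 0) - t * M $ i $ j) :: 'a ^ 'n ^ 'n"
  have "(?B *v v) $ i = 0" for i
  proof -
    have "(?B *v v) $ i = v $ i - t * (M *v v) $ i"
      by (simp add: matrix_vector_mult_def left_diff_distrib sum_subtractf sum_distrib_left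
          if_distrib[of "\<lambda>x. x * _"] mult.assoc cong: if_cong)
    also have "\<dots> = 0"
      using assms by (simp flip: mult.assoc)
    finally show ?thesis .
  qed
  then have "?B *v v = 0"
    by (simp add: vec_eq_iff)
  then have "\<not> invertible ?B"
    using \<open>v \<noteq> 0\<close> by (auto simp: invertible_left_inverse matrix_left_invertible_ker)
  then show ?thesis
    by (simp add: invertible_det_nz)
qed

text \<open>
  Nonzero eigenvalues are inverses of roots of \<open>det (I - t M)\<close>, which as a polynomial in \<open>t\<close> is
  nonzero because its value at \<open>0\<close> is \<open>1\<close>.
\<close>

lemma finite_complex_spectrum: "finite (complex_spectrum M)"
proof -
  define N where "N = map_matrix complex_of_real M"
  define p where "p = det (\<chi> i j. [: if i = j then 1 else 0, - N $ i $ j :])"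
  have p: "poly p t = det (\<chi> i j. (if i = j then 1 else 0) - t * N $ i $ j)" for t
    by (simp add: p_def poly_det)
  have "poly p 0 = det (mat 1 :: complex ^ 'a ^ 'a)"
    by (simp add: p mat_def)
  then have "p \<noteq> 0"
    by auto
  then have "finite (insert 0 (inverse ` {t. poly p t = 0}))"
    by (simp add: poly_roots_finite)
  moreover have "complex_spectrum M \<subseteq> insert 0 (inverse ` {t. poly p t = 0})"
  proof
    fix c assume "c \<in> complex_spectrum M"
    then obtain v where v: "v \<noteq> 0" "N *v v = c *s v"
      by (auto simp: complex_spectrum_def N_def)
    show "c \<in> insert 0 (inverse ` {t. poly p t = 0})"
    proof (cases "c = 0")
      case False
      then have "poly p (inverse c) = 0"
        unfolding p by (intro eigenvector_imp_det_eq_0[OF v(2,1)]) simp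
      then have "c \<in> inverse ` {t. poly p t = 0}"
        by (intro image_eqI[of _ _ "inverse c"]) simp_all
      then show ?thesis by simp
    qed simp
  qed
  ultimately show ?thesis
    by (rule finite_subset[rotated])
qed

text \<open>Read over the complex numbers, \<open>x\<close> is still an eigenvector, so
  \<open>c\<close> lies in the spectrum; finiteness of the spectrum makes \<open>Max\<close> an
  upper bound.\<close>

lemma real_eigenvalue_le_pf_eigenvalue:
  fixes M :: "real ^ 'n ^ 'n"
  assumes "M *v x = c *\<^sub>R x" "x \<noteq> 0"
  shows "\<bar>c\<bar> \<le> pf_eigenvalue M"
proof -
  define v :: "complex ^ 'n" where "v = (\<chi> i. complex_of_real (x $ i))"
  have "v \<noteq> 0"
    using assms(2) by (auto simp: v_def vec_eq_iff)
  moreover have "map_matrix complex_of_real M *v v = complex_of_real c *s v"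
  proof -
    have "(\<Sum>j\<in>UNIV. M $ i $ j * x $ j) = c * x $ i" for i
      using arg_cong[OF assms(1), of "\<lambda>u. u $ i"] by (simp add: matrix_vector_mult_def)
    then show ?thesis
      by (simp add: vec_eq_iff v_def matrix_vector_mult_def map_matrix_def
          flip: of_real_mult of_real_sum)
  qed
  ultimately have "complex_of_real c \<in> complex_spectrum M"
    by (auto simp: complex_spectrum_def)
  then have "cmod (complex_of_real c) \<le> pf_eigenvalue M"
    unfolding pf_eigenvalue_def by (intro Max_ge finite_imageI finite_complex_spectrum imageI)
  then show ?thesis by simp
qed

section \<open>A positive vector that is strictly decreased\<close>

lemma matrix_vector_mult_mono:
  fixes A :: "real ^ 'n ^ 'm"
  assumes "0 \<le> A" "x \<le> y"
  shows "A *v x \<le> A *v y"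
  using assms unfolding less_eq_vec_def matrix_vector_mult_def
  by (auto intro!: sum_mono mult_left_mono)

lemma abs_matrix_vector_mult_le:
  fixes A :: "real ^ 'n ^ 'm"
  shows "\<bar>A *v x\<bar> \<le> \<bar>A\<bar> *v \<bar>x\<bar>"
  unfolding less_eq_vec_def matrix_vector_mult_def
  by (auto simp: abs_vec_def simp flip: abs_mult intro!: sum_abs)

lemma abs_matrix_nonneg: "0 \<le> \<bar>A :: real ^ 'n ^ 'm\<bar>"
  by (simp add: less_eq_vec_def abs_vec_def)

lemma continuous_on_det:
  fixes F :: "'a::topological_space \<Rightarrow> real ^ 'n ^ 'n"
  assumes "\<And>i j. continuous_on S (\<lambda>t. F t $ i $ j)"
  shows "continuous_on S (\<lambda>t. det (F t))"
  unfolding det_def by (intro continuous_intros assms)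

text \<open>A nonzero kernel vector would make \<open>1 / t\<close>, which is at least
  \<open>1\<close>, an eigenvalue of \<open>A\<close>.\<close>

lemma invertible_mat_1_minus_scaled:
  fixes A :: "real ^ 'n ^ 'n"
  assumes "pf_eigenvalue A < 1" "0 \<le> t" "t \<le> 1"
  shows "invertible (mat 1 - t *\<^sub>R A)"
proof -
  have "x = 0" if "(mat 1 - t *\<^sub>R A) *v x = 0" for x
  proof (rule ccontr)
    assume "x \<noteq> 0"
    have x: "t *\<^sub>R (A *v x) = x"
      using that by (simp add: matrix_vector_mult_diff_rdistrib scaleR_matrix_vector_assoc)
    then have "t \<noteq> 0"
      using \<open>x \<noteq> 0\<close> by auto
    then have "A *v x = (1 / t) *\<^sub>R x"
      by (subst (2) x[symmetric]) simp
    then have "\<bar>1 / t\<bar> \<le> pf_eigenvalue A"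
      using \<open>x \<noteq> 0\<close> by (rule real_eigenvalue_le_pf_eigenvalue)
    moreover have "1 \<le> 1 / t"
      using assms \<open>t \<noteq> 0\<close> by simp
    ultimately show False
      using assms(1) by linarith
  qed
  then show ?thesis
    by (simp add: invertible_left_inverse matrix_left_invertible_ker)
qed

lemma positive_vector_exists:
  fixes A :: "real ^ 'n ^ 'n"
  assumes "0 \<le> A" "pf_eigenvalue A < 1"
  obtains v where "\<And>i. 1 \<le> v $ i" "A *v v = v - 1"
proof -
  define B where "B t = mat 1 - t *\<^sub>R A" for t
  \<comment> \<open>Cramer's rule for \<open>B t *v x t = 1\<close>: as quotients of determinants,
    the coordinates are visibly continuous in \<open>t\<close>.\<close>
  define x where "x t = (\<chi> k. det (\<chi> i j. if j = k then 1 else B t $ i $ j) / det (B t))" for t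
  define S where "S = {0..1::real}"
  have det: "det (B t) \<noteq> 0" if "t \<in> S" for t
    using that invertible_mat_1_minus_scaled[OF assms(2)]
    by (simp add: B_def S_def flip: invertible_det_nz)
  have x: "x t = 1 + t *\<^sub>R (A *v x t)" if "t \<in> S" for t
  proof -
    have "B t *v x t = 1"
      unfolding cramer[OF det[OF that]] by (simp only: x_def one_index)
    then show ?thesis
      by (simp add: B_def matrix_vector_mult_diff_rdistrib scaleR_matrix_vector_assoc algebra_simps)
  qed
  have cont_B: "continuous_on S (\<lambda>t. B t $ i $ j)" for i j
    by (auto simp: B_def intro!: continuous_intros)
  have cont_column: "continuous_on S (\<lambda>t. if j = k then 1 else B t $ i $ j)" for i j k
    by (cases "j = k") (simp_all add: cont_B)
  have cont_numerator: "continuous_on S (\<lambda>t. det (\<chi> i j. if j = k then 1 else B t $ i $ j))" for k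
    by (rule continuous_on_det, unfold vec_lambda_beta, rule cont_column)
  have cont_det: "continuous_on S (\<lambda>t. det (B t))"
    by (rule continuous_on_det) (rule cont_B)
  have "\<forall>t\<in>S. det (B t) \<noteq> 0"
    using det by blast
  then have cont_quotient:
    "continuous_on S (\<lambda>t. det (\<chi> i j. if j = k then 1 else B t $ i $ j) / det (B t))" for k
    by (rule continuous_on_divide[OF cont_numerator cont_det])
  have "continuous_on S (\<lambda>t. \<chi> k. det (\<chi> i j. if j = k then 1 else B t $ i $ j) / det (B t))"
    by (rule continuous_on_vec_lambda) (rule cont_quotient)
  moreover have "x = (\<lambda>t. \<chi> k. det (\<chi> i j. if j = k then 1 else B t $ i $ j) / det (B t))"
    by (rule ext) (rule x_def)
  ultimately have cont: "continuous_on S x"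
    by (simp only:)
  have x_ge_1: "1 \<le> x t $ i" if "t \<in> S" "0 \<le> x t" for t i
  proof -
    have "0 \<le> A *v x t"
      using matrix_vector_mult_mono[OF assms(1) that(2)] by simp
    then have "0 \<le> t * (A *v x t) $ i"
      using that(1) by (auto simp: S_def less_eq_vec_def)
    then show ?thesis
      using arg_cong[OF x[OF that(1)], of "\<lambda>u. u $ i"] by simp
  qed
  \<comment> \<open>By \<open>x_ge_1\<close>, nonnegativity of \<open>x t\<close> on
    \<open>S\<close> is the same as strict positivity, so \<open>T\<close> is the preimage of a
    closed set and also of an open one. Being clopen and containing \<open>0\<close>, it is the
    whole interval.\<close>
  define T where "T = S \<inter> x -` {0..}"
  have "0 < x t $ i" if "t \<in> S" "0 \<le> x t" for t i
    using x_ge_1[OF that, of i] by simp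
  then have "T = S \<inter> x -` (\<Inter>i. {z. 0 < z $ i})"
    unfolding T_def by (intro equalityI subsetI) (simp_all add: less_eq_vec_def less_imp_le)
  moreover have "open (\<Inter>i. {z :: real ^ 'n. 0 < z $ i})"
    by (intro open_INT ballI) (auto simp: open_halfspace_component_gt_cart)
  ultimately have "openin (top_of_set S) T"
    using cont by (simp add: continuous_openin_preimage_gen)
  moreover have "closed {0 :: real ^ 'n..}"
  proof -
    have "{0 :: real ^ 'n..} = (\<Inter>i. {z. 0 \<le> z $ i})"
      by (auto simp: less_eq_vec_def)
    then show ?thesis
      by (auto intro!: closed_INT closed_halfspace_component_ge_cart)
  qed
  then have "closedin (top_of_set S) T"
    unfolding T_def by (intro continuous_closedin_preimage cont)
  moreover have "connected S"
    by (simp add: S_def)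
  ultimately have "T = {} \<or> T = S"
    by (auto simp: connected_clopen)
  moreover have "0 \<in> T"
    using x[of 0] by (simp add: T_def S_def less_eq_vec_def)
  moreover have "1 \<in> S"
    by (simp add: S_def)
  ultimately have "0 \<le> x 1"
    by (auto simp: T_def)
  show ?thesis
  proof
    show "1 \<le> x 1 $ i" for i
      using \<open>1 \<in> S\<close> \<open>0 \<le> x 1\<close> by (rule x_ge_1)
    show "A *v x 1 = x 1 - 1"
      using x[OF \<open>1 \<in> S\<close>] by (simp add: algebra_simps)
  qed
qed

text \<open>Let \<open>v\<close> be the positive vector above and \<open>m\<close> the least number
  with \<open>x \<le> m v\<close>. Then \<open>x \<le> A x \<le> m (v - 1)\<close>, while
  \<open>x\<close> touches \<open>m v\<close> in some coordinate \<open>k\<close>; comparing there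
  gives \<open>m \<le> 0\<close>.\<close>

lemma le_mult_imp_nonpos:
  fixes A :: "real ^ 'n ^ 'n"
  assumes "0 \<le> A" "pf_eigenvalue A < 1" "x \<le> A *v x"
  shows "x \<le> 0"
proof -
  obtain v where v: "\<And>i. 1 \<le> v $ i" and Av: "A *v v = v - 1"
    using positive_vector_exists[OF assms(1,2)] by blast
  have v_pos: "0 < v $ i" for i
    using v[of i] by simp
  define m where "m = Max (range (\<lambda>i. x $ i / v $ i))"
  have "x $ i / v $ i \<le> m" for i
    by (simp add: m_def)
  then have xm: "x \<le> m *\<^sub>R v"
    using v_pos by (simp add: less_eq_vec_def pos_divide_le_eq)
  have "m \<in> range (\<lambda>i. x $ i / v $ i)"
    unfolding m_def by (intro Max_in) auto
  then obtain k where k: "m = x $ k / v $ k"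
    by auto
  have "x \<le> m *\<^sub>R (v - 1)"
    using assms(3) matrix_vector_mult_mono[OF assms(1) xm]
    by (simp add: Av matrix_vector_mult_scaleR)
  then have "x $ k \<le> m * (v $ k - 1)"
    by (auto simp: less_eq_vec_def)
  moreover have "x $ k = m * v $ k"
    using k v_pos[of k] by simp
  ultimately have "m \<le> 0"
    by (simp add: right_diff_distrib)
  then have "m * v $ i \<le> 0" for i
    using v_pos[of i] by (simp add: mult_nonpos_nonneg)
  then have "m *\<^sub>R v \<le> 0"
    by (simp add: less_eq_vec_def)
  then show ?thesis
    using xm by (rule order_trans[rotated])
qed

lemma matrix_mul_matrix_inv:
  assumes "invertible A"
  shows "A ** matrix_inv A = mat 1"
  unfolding matrix_inv_def
  by (rule someI2_ex) (use assms in \<open>auto simp: invertible_def\<close>)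

text \<open>The exact solution \<open>z\<close> of \<open>z = A z + g\<close> serves as comparison:
  \<open>x - z\<close> satisfies the hypothesis of \<open>le_mult_imp_nonpos\<close>. This turns an
  implicit bound on the distance of two equilibria into an explicit one.\<close>

lemma le_mult_add_imp_le_matrix_inv:
  fixes A :: "real ^ 'n ^ 'n"
  assumes "0 \<le> A" "pf_eigenvalue A < 1" "x \<le> A *v x + g"
  shows "x \<le> matrix_inv (mat 1 - A) *v g"
proof -
  define z where "z = matrix_inv (mat 1 - A) *v g"
  have "invertible (mat 1 - A)"
    using invertible_mat_1_minus_scaled[OF assms(2), of 1] by simp
  then have "(mat 1 - A) *v z = g"
    by (simp add: z_def matrix_vector_mul_assoc matrix_mul_matrix_inv)
  then have "g = z - A *v z"
    by (simp add: matrix_vector_mult_diff_rdistrib)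
  then have "x - z \<le> A *v (x - z)"
    using diff_right_mono[OF assms(3), of z] by (simp add: matrix_vector_mult_diff_distrib)
  then have "x - z \<le> 0"
    by (rule le_mult_imp_nonpos[OF assms(1,2)])
  then show ?thesis
    by (simp add: z_def)
qed

section \<open>Fixed points\<close>

lemma norm_le_if_abs_le:
  fixes x y :: "real ^ 'n"
  assumes "\<bar>x\<bar> \<le> \<bar>y\<bar>"
  shows "norm x \<le> norm y"
  using assms by (intro norm_le_componentwise_cart) (auto simp: less_eq_vec_def abs_vec_def)

lemma norm_abs_vec: "norm \<bar>x :: real ^ 'n\<bar> = norm x"
  by (intro antisym norm_le_if_abs_le) simp_all

text \<open>\<open>F\<close> need not contract the Euclidean norm, so Brouwer's theorem on the box
  \<open>[-s v, s v]\<close> is used; the bound on \<open>F\<close> yields both continuity and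
  invariance of the box.\<close>

lemma fixed_point_exists:
  fixes F :: "real ^ 'n \<Rightarrow> real ^ 'n"
  assumes "0 \<le> A" "pf_eigenvalue A < 1"
    and F: "\<And>r s. \<bar>F r - F s\<bar> \<le> A *v \<bar>r - s\<bar>"
  shows "\<exists>x. F x = x"
proof -
  obtain v where v: "\<And>i. 1 \<le> v $ i" and Av: "A *v v = v - 1"
    using positive_vector_exists[OF assms(1,2)] by blast
  \<comment> \<open>\<open>A\<close> maps \<open>s v\<close> to \<open>s (v - 1)\<close>, leaving
    room \<open>s\<close> in every coordinate, just enough to absorb \<open>F 0\<close>.\<close>
  define s where "s = norm (F 0)"
  define C where "C = cbox (- (s *\<^sub>R v)) (s *\<^sub>R v)"
  have C_iff: "r \<in> C \<longleftrightarrow> \<bar>r\<bar> \<le> s *\<^sub>R v" for r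
    by (auto simp: C_def mem_box_cart less_eq_vec_def abs_vec_def abs_le_iff minus_le_iff)
  have "norm (F r - F r') \<le> norm (A *v \<bar>r - r'\<bar>)" for r r'
    using F[of r r'] by (intro norm_le_if_abs_le) (metis abs_ge_self order_trans)
  also have "norm (A *v \<bar>r - r'\<bar>) \<le> onorm ((*v) A) * norm (r - r')" for r r'
    using onorm[OF matrix_vector_mul_bounded_linear, of A "\<bar>r - r'\<bar>"] by (simp add: norm_abs_vec)
  finally have "(onorm ((*v) A))-lipschitz_on C F"
    by (intro lipschitz_onI) (auto simp: dist_norm onorm_pos_le matrix_vector_mul_bounded_linear)
  then have "continuous_on C F"
    by (rule lipschitz_on_continuous_on)
  moreover have "F \<in> C \<rightarrow> C"
  proof
    fix r assume "r \<in> C"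
    then have "A *v \<bar>r\<bar> \<le> s *\<^sub>R (v - 1)"
      using matrix_vector_mult_mono[OF assms(1), of "\<bar>r\<bar>" "s *\<^sub>R v"]
      by (simp add: C_iff Av matrix_vector_mult_scaleR)
    then have "\<bar>F r - F 0\<bar> \<le> s *\<^sub>R (v - 1)"
      using F[of r 0] by simp
    then have le: "\<bar>F r $ i - F 0 $ i\<bar> \<le> s * (v $ i - 1)" for i
      by (auto simp: less_eq_vec_def abs_vec_def)
    have "\<bar>F r $ i\<bar> \<le> s * v $ i" for i
    proof -
      have "\<bar>F 0 $ i\<bar> \<le> s"
        unfolding s_def by (rule component_le_norm_cart)
      then show ?thesis
        using le[of i] unfolding right_diff_distrib by linarith
    qed
    then show "F r \<in> C"
      by (simp add: C_iff less_eq_vec_def abs_vec_def)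
  qed
  moreover have "C \<noteq> {}"
  proof -
    have "0 \<le> v $ i" for i
      using v[of i] by simp
    then show ?thesis
      by (auto intro!: exI[of _ 0] simp: C_iff less_eq_vec_def s_def simp flip: ex_in_conv)
  qed
  moreover have "compact C" "convex C"
    by (simp_all add: C_def)
  ultimately show ?thesis
    using brouwer[of C F] by metis
qed

section \<open>Unique solvability and Lipschitz estimates for the equilibrium and the
  controller\<close>

theorem theorem1:
  fixes \<phi> :: "real ^ 'q \<Rightarrow> real ^ 'q"
    and W :: "real ^ 'q ^ 'q"
    and U :: "real ^ 'p ^ 'q"
    and V :: "real ^ 'q ^ 'm"
    and K :: "real ^ 'p ^ 'm"
    and b :: "real ^ 'q"
    and d :: "real ^ 'm"
  assumes "acts_componentwise \<phi>"
    and "\<forall>r s. \<bar>\<phi> r - \<phi> s\<bar> \<le> \<bar>r - s\<bar>"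
    and "pf_eigenvalue \<bar>W\<bar> < 1"
  shows "(\<forall>(y :: real ^ 'p) (b' :: real ^ 'q). \<exists>!\<eta>. \<eta> = \<phi> (W *v \<eta> + U *v y + b'))
    \<and> invertible (mat 1 - \<bar>W\<bar>)
    \<and> (\<forall>y1 y2. \<bar>equilibrium \<phi> W U b y1 - equilibrium \<phi> W U b y2\<bar>
          \<le> (matrix_inv (mat 1 - \<bar>W\<bar>) ** \<bar>U\<bar>) *v \<bar>y1 - y2\<bar>)
    \<and> (\<exists>L. L-lipschitz_on UNIV (controller \<phi> W U b K V d))
    \<and> (\<forall>y1 y2. \<bar>controller \<phi> W U b K V d y1 - controller \<phi> W U b K V d y2\<bar>
          \<le> (\<bar>K\<bar> + \<bar>V\<bar> ** matrix_inv (mat 1 - \<bar>W\<bar>) ** \<bar>U\<bar>) *v \<bar>y1 - y2\<bar>)"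
proof -
  define A where "A = \<bar>W\<bar>"
  define R where "R = matrix_inv (mat 1 - A)"
  define N where "N = \<bar>K\<bar> + \<bar>V\<bar> ** R ** \<bar>U\<bar>"
  define \<eta> where "\<eta> = equilibrium \<phi> W U b"
  define \<pi> where "\<pi> = controller \<phi> W U b K V d"
  have A: "0 \<le> A" "pf_eigenvalue A < 1"
    using assms(3) by (auto simp: A_def abs_matrix_nonneg)
  \<comment> \<open>Equal offsets \<open>c = c'\<close> give existence and uniqueness; the offsets
    \<open>U y1 + b\<close> and \<open>U y2 + b\<close> give the estimate between
    equilibria.\<close>
  have step: "\<bar>\<phi> (W *v r + c) - \<phi> (W *v s + c')\<bar> \<le> A *v \<bar>r - s\<bar> + \<bar>c - c'\<bar>" for r s c c'
  proof -
    have "\<bar>\<phi> (W *v r + c) - \<phi> (W *v s + c')\<bar> \<le> \<bar>(W *v r + c) - (W *v s + c')\<bar>"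
      using assms(2) by blast
    also have "\<dots> = \<bar>W *v (r - s) + (c - c')\<bar>"
      by (simp add: matrix_vector_mult_diff_distrib algebra_simps)
    also have "\<dots> \<le> \<bar>W *v (r - s)\<bar> + \<bar>c - c'\<bar>"
      by (rule abs_triangle_ineq)
    also have "\<dots> \<le> A *v \<bar>r - s\<bar> + \<bar>c - c'\<bar>"
      unfolding A_def by (intro add_right_mono abs_matrix_vector_mult_le)
    finally show ?thesis .
  qed
  have unique: "\<exists>!\<eta>. \<eta> = \<phi> (W *v \<eta> + U *v y + b')" for y b'
  proof -
    have *: "\<bar>\<phi> (W *v r + U *v y + b') - \<phi> (W *v s + U *v y + b')\<bar> \<le> A *v \<bar>r - s\<bar>" for r s
      using step[of r "U *v y + b'" s "U *v y + b'"] by (simp add: add.assoc)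
    obtain x where x: "\<phi> (W *v x + U *v y + b') = x"
      using fixed_point_exists[OF A *] by blast
    show ?thesis
    proof (rule ex1I[of _ x])
      show "x = \<phi> (W *v x + U *v y + b')"
        using x by simp
      fix z assume z: "z = \<phi> (W *v z + U *v y + b')"
      have "\<bar>z - x\<bar> \<le> A *v \<bar>z - x\<bar>"
        using *[of z x] x z by simp
      then have "\<bar>z - x\<bar> \<le> 0"
        by (rule le_mult_imp_nonpos[OF A])
      then show "z = x"
        by simp
    qed
  qed
  \<comment> \<open>Uniqueness at the bias \<open>b\<close> makes the definite description in
    \<open>equilibrium\<close> an actual solution.\<close>
  have \<eta>: "\<eta> y = \<phi> (W *v \<eta> y + U *v y + b)" for y
    unfolding \<eta>_def equilibrium_def by (rule theI'[OF unique])
  have eta_le: "\<bar>\<eta> y1 - \<eta> y2\<bar> \<le> (R ** \<bar>U\<bar>) *v \<bar>y1 - y2\<bar>" for y1 y2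
  proof -
    have "\<bar>\<eta> y1 - \<eta> y2\<bar> \<le> A *v \<bar>\<eta> y1 - \<eta> y2\<bar> + \<bar>U *v (y1 - y2)\<bar>"
      using step[of "\<eta> y1" "U *v y1 + b" "\<eta> y2" "U *v y2 + b"]
      by (simp add: matrix_vector_mult_diff_distrib flip: \<eta> add.assoc)
    also have "\<dots> \<le> A *v \<bar>\<eta> y1 - \<eta> y2\<bar> + \<bar>U\<bar> *v \<bar>y1 - y2\<bar>"
      by (intro add_left_mono abs_matrix_vector_mult_le)
    finally show ?thesis
      unfolding R_def by (simp add: le_mult_add_imp_le_matrix_inv[OF A] flip: matrix_vector_mul_assoc)
  qed
  have pi_le: "\<bar>\<pi> y1 - \<pi> y2\<bar> \<le> N *v \<bar>y1 - y2\<bar>" for y1 y2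
  proof -
    have "\<pi> y1 - \<pi> y2 = K *v (y1 - y2) + V *v (\<eta> y1 - \<eta> y2)"
      by (simp add: \<pi>_def controller_def \<eta>_def matrix_vector_mult_diff_distrib)
    then have "\<bar>\<pi> y1 - \<pi> y2\<bar> \<le> \<bar>K *v (y1 - y2)\<bar> + \<bar>V *v (\<eta> y1 - \<eta> y2)\<bar>"
      by (simp add: abs_triangle_ineq)
    also have "\<dots> \<le> \<bar>K\<bar> *v \<bar>y1 - y2\<bar> + \<bar>V\<bar> *v \<bar>\<eta> y1 - \<eta> y2\<bar>"
      by (intro add_mono abs_matrix_vector_mult_le)
    \<comment> \<open>The bound on the equilibria passes through \<open>\<bar>V\<bar>\<close>
      because a nonnegative matrix is monotone.\<close>
    also have "\<dots> \<le> \<bar>K\<bar> *v \<bar>y1 - y2\<bar> + \<bar>V\<bar> *v ((R ** \<bar>U\<bar>) *v \<bar>y1 - y2\<bar>)"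
      by (intro add_left_mono matrix_vector_mult_mono abs_matrix_nonneg eta_le)
    also have "\<dots> = N *v \<bar>y1 - y2\<bar>"
      by (simp add: N_def matrix_vector_mult_add_rdistrib matrix_vector_mul_assoc matrix_mul_assoc)
    finally show ?thesis .
  qed
  \<comment> \<open>The componentwise bound becomes a norm bound, as the Euclidean norm is monotone
    in absolute values.\<close>
  have "(onorm ((*v) N))-lipschitz_on UNIV \<pi>"
  proof (rule lipschitz_onI)
    fix y1 y2
    have "norm (\<pi> y1 - \<pi> y2) \<le> norm (N *v \<bar>y1 - y2\<bar>)"
      using pi_le[of y1 y2] by (intro norm_le_if_abs_le) (metis abs_ge_self order_trans)
    also have "\<dots> \<le> onorm ((*v) N) * norm (y1 - y2)"
      using onorm[OF matrix_vector_mul_bounded_linear, of N "\<bar>y1 - y2\<bar>"] by (simp add: norm_abs_vec)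
    finally show "dist (\<pi> y1) (\<pi> y2) \<le> onorm ((*v) N) * dist y1 y2"
      by (simp add: dist_norm)
  qed (simp add: onorm_pos_le matrix_vector_mul_bounded_linear)
  moreover have "invertible (mat 1 - A)"
    using invertible_mat_1_minus_scaled[OF A(2), of 1] by simp
  ultimately show ?thesis
    using unique eta_le pi_le unfolding \<eta>_def \<pi>_def N_def R_def A_def by blast
qed

end
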